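(* Let $2\le k\le d$ and let $X$ be a random vector with values in $\mathbb S_+^{d-1}=\{x\in\mathbb R^d: x_i\ge 0\ \forall i,\ \|x\|_2=1\}$ such that $E(X_1)=\cdots=E(X_d)=\mu>0$. Let $(I_1,\ldots,I_k)$ be a partition of $\{1,\ldots,d\}$ into non-empty sets such that $\Pr(X\in F_{I_1}\cup\cdots\cup F_{I_k})=1$. If $d_1=|I_1|,\ldots,d_k=|I_k|$ yield the maximum in $$\max_{\substack{d_1,\ldots,d_k\in\mathbb N_0\\ d_1+\cdots+d_k=d}} \big(\sqrt{d_1}+\cdots+\sqrt{d_k}\big),$$ then there exists a maximizer $(x_1,\ldots,x_k)$ of $$\max_{x_1,\ldots,x_k\in\mathbb S_+^{d-1}} E\Big(\max_{1\le i\le k}x_i^\top X\Big)$$ (that is, optimal centroids of spherical $k$-means clustering) with $x_i\in F_{I_i}$ for all $i=1,\ldots,k$. For $k=2$ the condition that $d_1=|I_1|$, $d_2=|I_2|$ yield the maximum in $$\max_{\substack{d_1,d_2\in\mathbb N_0\\ d_1+d_2=d}} \big(\sqrt{d_1}+\sqrt{d_2}\big)$$ is equivalent to $\big||I_1|-|I_2|\big|\le 1$.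
   Context: $\mathbb N_0=\{0,1,2,\ldots\}$. For $I\subset\{1,\ldots,d\}$ non-empty, the face is $F_I=\{x\in\mathbb R^d: x_i\ge 0\ \forall i,\ x_j=0\ \forall j\notin I\}$. Labelling convention (no loss of generality): the coordinates are ordered so that the indices in $I_i$ are smaller than those in $I_j$ for $i<j$. *)

theory Defs
  imports "HOL-Probability.Probability"
begin

text \<open>
  Vectors of dimension \<open>d\<close> are elements of \<^typ>\<open>real ^ 'n\<close>, so that \<open>d = CARD('n)\<close> and the
  coordinates are indexed by \<open>'n\<close> instead of \<open>{1, \<dots>, d}\<close>. Tuples of length \<open>k\<close> are functions
  on \<^typ>\<open>nat\<close> of which only the values on \<open>{1..k}\<close> matter.
\<close>

definition nonneg_sphere :: "(real ^ 'n) set" where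
  "nonneg_sphere = {x. (\<forall>i. 0 \<le> x $ i) \<and> norm x = 1}"

definition face :: "'n set \<Rightarrow> (real ^ 'n) set" where
  "face I = {x. (\<forall>i. 0 \<le> x $ i) \<and> (\<forall>j. j \<notin> I \<longrightarrow> x $ j = 0)}"

definition indexed_partition :: "nat \<Rightarrow> (nat \<Rightarrow> 'n set) \<Rightarrow> bool" where
  "indexed_partition k I \<longleftrightarrow>
     (\<forall>i\<in>{1..k}. I i \<noteq> {}) \<and> disjoint_family_on I {1..k} \<and> (\<Union>i\<in>{1..k}. I i) = UNIV"

text \<open>
  The natural numbers \<open>n 1, \<dots>, n k\<close> with sum \<open>d\<close> maximize the sum of their square roots
  among all such \<open>k\<close>-tuples; zero entries are allowed.
\<close>

definition yields_max_sqrt_sum :: "nat \<Rightarrow> nat \<Rightarrow> (nat \<Rightarrow> nat) \<Rightarrow> bool" where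
  "yields_max_sqrt_sum d k n \<longleftrightarrow>
     is_arg_max (\<lambda>m. \<Sum>i=1..k. sqrt (real (m i))) (\<lambda>m. (\<Sum>i=1..k. m i) = d) n"

text \<open>Optimal centroids of spherical \<open>k\<close>-means clustering for the random vector \<open>X\<close> on \<open>M\<close>.\<close>

definition optimal_centroids ::
  "'a measure \<Rightarrow> ('a \<Rightarrow> real ^ 'n) \<Rightarrow> nat \<Rightarrow> (nat \<Rightarrow> real ^ 'n) \<Rightarrow> bool" where
  "optimal_centroids M X k x \<longleftrightarrow>
     is_arg_max (\<lambda>y. \<integral>\<omega>. (MAX i\<in>{1..k}. y i \<bullet> X \<omega>) \<partial>M)
       (\<lambda>y. \<forall>i\<in>{1..k}. y i \<in> nonneg_sphere) x"

end

theory Submission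
  imports Defs
begin

text \<open>
  Let \<open>y\<^sub>1, \<dots>, y\<^sub>k\<close> be nonnegative unit vectors. Because \<open>X\<close> has nonnegative coordinates, taking
  the maximum separately in every coordinate can only increase the value:
  \<open>max\<^sub>i y\<^sub>i \<bullet> X \<le> \<Sum>\<^sub>j X\<^sub>j max\<^sub>i y\<^sub>i\<^sub>j\<close>. In expectation the right-hand side is
  \<open>\<mu> \<Sum>\<^sub>j max\<^sub>i y\<^sub>i\<^sub>j\<close>, a quantity in which the distribution of \<open>X\<close> enters only through \<open>\<mu>\<close>. If
  each coordinate \<open>j\<close> is assigned to an index \<open>i\<close> at which \<open>y\<^sub>i\<^sub>j\<close> is largest, and \<open>n\<^sub>i\<close> coordinates
  are assigned to \<open>i\<close>, then the Cauchy-Schwarz inequality bounds the sum over the coordinates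
  assigned to \<open>i\<close> by \<open>sqrt n\<^sub>i\<close>. Hence no centroids have value above \<open>\<mu> \<Sum>\<^sub>i sqrt n\<^sub>i\<close> for some
  numbers \<open>n\<^sub>i\<close> with sum \<open>d\<close> (\<open>expectation_Max_inner_le\<close>).

  The normalized indicator vectors of the blocks \<open>I\<^sub>i\<close> attain this bound with \<open>n\<^sub>i = |I\<^sub>i|\<close>: when
  \<open>X\<close> lies in one of the faces almost surely, all but one of their inner products with \<open>X\<close> vanish,
  so that the maximum is the sum, whose expectation is \<open>\<mu> \<Sum>\<^sub>i sqrt |I\<^sub>i|\<close>
  (\<open>expectation_Max_normalized_indicator\<close>). If the sizes of the blocks maximize the sum of the
  square roots, these vectors are therefore optimal.

  For \<open>k = 2\<close>, the square of \<open>sqrt a + sqrt b\<close> is \<open>a + b + 2 sqrt (a b)\<close>, so that with a fixed sum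
  one maximizes the product \<open>a b\<close>, which is largest exactly when \<open>a\<close> and \<open>b\<close> are as equal as
  possible.
\<close>

section \<open>The upper bound\<close>

lemma sum_component_le_sqrt_card:
  fixes y :: "real ^ 'n"
  assumes "norm y = 1"
  shows "(\<Sum>j\<in>S. y $ j) \<le> sqrt (card S)"
proof -
  have "(\<Sum>j\<in>S. y $ j)\<^sup>2 \<le> (\<Sum>j\<in>S. (y $ j)\<^sup>2) * (\<Sum>j\<in>S. 1\<^sup>2)"
    using Cauchy_Schwarz_ineq_sum[of "\<lambda>j. y $ j" "\<lambda>_. 1" S] by simp
  also have "\<dots> = (\<Sum>j\<in>S. (y $ j)\<^sup>2) * card S"
    by simp
  also have "\<dots> \<le> (\<Sum>j\<in>UNIV. (y $ j)\<^sup>2) * card S"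
    by (intro mult_right_mono sum_mono2) auto
  also have "(\<Sum>j\<in>UNIV. (y $ j)\<^sup>2) = (norm y)\<^sup>2"
    by (simp add: norm_vec_def L2_set_def sum_nonneg)
  finally show ?thesis
    using assms by (simp add: real_le_rsqrt)
qed

text \<open>
  Assign every coordinate to an index at which the component is largest and regroup the sum by
  the assigned index.
\<close>

lemma ex_sum_Max_component_le:
  fixes y :: "nat \<Rightarrow> real ^ 'n"
  assumes "1 \<le> k" and "\<And>i. i \<in> {1..k} \<Longrightarrow> norm (y i) = 1"
  obtains n :: "nat \<Rightarrow> nat"
  where "(\<Sum>i=1..k. n i) = CARD('n)"
    and "(\<Sum>j\<in>UNIV. MAX i\<in>{1..k}. y i $ j) \<le> (\<Sum>i=1..k. sqrt (real (n i)))"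
proof -
  have "(MAX i\<in>{1..k}. y i $ j) \<in> (\<lambda>i. y i $ j) ` {1..k}" for j
    using assms(1) by (intro Max_in) auto
  then obtain f where f: "\<And>j. f j \<in> {1..k}" "\<And>j. (MAX i\<in>{1..k}. y i $ j) = y (f j) $ j"
    unfolding image_iff by metis
  have regroup: "(\<Sum>i=1..k. \<Sum>j\<in>{j. f j = i}. h j) = (\<Sum>j\<in>UNIV. h j)"
    for h :: "'n \<Rightarrow> 'b::comm_monoid_add"
  proof -
    have "range f \<subseteq> {1..k}"
      using f(1) by blast
    then show ?thesis
      using sum.group[of UNIV "{1..k}" f h] by simp
  qed
  show thesis
  proof
    show "(\<Sum>i=1..k. card {j. f j = i}) = CARD('n)"
      using regroup[of "\<lambda>_. 1::nat"] by simp
    have "(\<Sum>j\<in>UNIV. MAX i\<in>{1..k}. y i $ j) = (\<Sum>i=1..k. \<Sum>j\<in>{j. f j = i}. y i $ j)"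
      unfolding f(2) regroup[symmetric] by (intro sum.cong) auto
    also have "\<dots> \<le> (\<Sum>i=1..k. sqrt (card {j. f j = i}))"
      by (intro sum_mono sum_component_le_sqrt_card assms(2))
    finally show "(\<Sum>j\<in>UNIV. MAX i\<in>{1..k}. y i $ j) \<le> (\<Sum>i=1..k. sqrt (card {j. f j = i}))" .
  qed
qed

lemma integrable_component_sphere:
  fixes X :: "'a \<Rightarrow> real ^ 'n"
  assumes "prob_space M" and "X \<in> borel_measurable M" and "\<forall>\<omega>\<in>space M. X \<omega> \<in> nonneg_sphere"
  shows "integrable M (\<lambda>\<omega>. X \<omega> $ j)"
proof -
  interpret prob_space M by fact
  show ?thesis
  proof (rule integrable_const_bound[of _ 1])
    show "AE \<omega> in M. norm (X \<omega> $ j) \<le> 1"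
    proof (rule AE_I2)
      fix \<omega> assume "\<omega> \<in> space M"
      then have "norm (X \<omega>) = 1"
        using assms(3) by (simp add: nonneg_sphere_def)
      then show "norm (X \<omega> $ j) \<le> 1"
        using component_le_norm_cart[of "X \<omega>" j] by simp
    qed
    show "(\<lambda>\<omega>. X \<omega> $ j) \<in> borel_measurable M"
      using assms(2) by (simp add: cart_eq_inner_axis)
  qed
qed

text \<open>
  Since \<open>X\<close> is nonnegative, the vector \<open>c\<close> of the coordinatewise maxima of the centroids satisfies
  \<open>y\<^sub>i \<bullet> X \<le> c \<bullet> X\<close> for all \<open>i\<close> at once, and \<open>c \<bullet> X\<close> has the expectation \<open>\<mu> \<Sum>\<^sub>j c\<^sub>j\<close>.
\<close>

lemma expectation_Max_inner_le:
  fixes X :: "'a \<Rightarrow> real ^ 'n" and y :: "nat \<Rightarrow> real ^ 'n"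
  assumes M: "prob_space M" and X: "X \<in> borel_measurable M" "\<forall>\<omega>\<in>space M. X \<omega> \<in> nonneg_sphere"
    and mean: "\<forall>j. (\<integral>\<omega>. X \<omega> $ j \<partial>M) = \<mu>" and "0 < \<mu>"
    and "1 \<le> k" and y: "\<forall>i\<in>{1..k}. y i \<in> nonneg_sphere"
  obtains n :: "nat \<Rightarrow> nat"
  where "(\<Sum>i=1..k. n i) = CARD('n)"
    and "(\<integral>\<omega>. (MAX i\<in>{1..k}. y i \<bullet> X \<omega>) \<partial>M) \<le> \<mu> * (\<Sum>i=1..k. sqrt (real (n i)))"
proof -
  define c where "c j = (MAX i\<in>{1..k}. y i $ j)" for j
  have le_c: "y i $ j \<le> c j" if "i \<in> {1..k}" for i j
    unfolding c_def using that by (intro Max_ge) auto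
  have c_nonneg: "0 \<le> c j" for j
  proof -
    have "0 \<le> y 1 $ j"
      using y \<open>1 \<le> k\<close> by (simp add: nonneg_sphere_def)
    also have "\<dots> \<le> c j"
      using \<open>1 \<le> k\<close> by (intro le_c) simp
    finally show ?thesis .
  qed
  have int: "integrable M (\<lambda>\<omega>. c j * X \<omega> $ j)" for j
    by (intro integrable_mult_right integrable_component_sphere M X)
  obtain n where n: "(\<Sum>i=1..k. n i) = CARD('n)" "(\<Sum>j\<in>UNIV. c j) \<le> (\<Sum>i=1..k. sqrt (real (n i)))"
    using ex_sum_Max_component_le[OF \<open>1 \<le> k\<close>, of y] y unfolding c_def nonneg_sphere_def by blast
  have "(\<integral>\<omega>. (MAX i\<in>{1..k}. y i \<bullet> X \<omega>) \<partial>M) \<le> (\<integral>\<omega>. (\<Sum>j\<in>UNIV. c j * X \<omega> $ j) \<partial>M)"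
  proof (rule integral_mono')
    show "integrable M (\<lambda>\<omega>. \<Sum>j\<in>UNIV. c j * X \<omega> $ j)"
      using int by simp
  next
    fix \<omega> assume "\<omega> \<in> space M"
    then have X_nonneg: "0 \<le> X \<omega> $ j" for j
      using X(2) by (auto simp: nonneg_sphere_def)
    then show "0 \<le> (\<Sum>j\<in>UNIV. c j * X \<omega> $ j)"
      by (intro sum_nonneg mult_nonneg_nonneg c_nonneg)
    have "y i \<bullet> X \<omega> \<le> (\<Sum>j\<in>UNIV. c j * X \<omega> $ j)" if "i \<in> {1..k}" for i
      unfolding inner_vec_def inner_real_def
      by (intro sum_mono mult_right_mono le_c X_nonneg that)
    then show "(MAX i\<in>{1..k}. y i \<bullet> X \<omega>) \<le> (\<Sum>j\<in>UNIV. c j * X \<omega> $ j)"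
      using \<open>1 \<le> k\<close> by (subst Max_le_iff) auto
  qed
  also have "\<dots> = \<mu> * (\<Sum>j\<in>UNIV. c j)"
    using int mean by (simp add: sum_distrib_left mult.commute)
  also have "\<dots> \<le> \<mu> * (\<Sum>i=1..k. sqrt (real (n i)))"
    using n(2) \<open>0 < \<mu>\<close> by (intro mult_left_mono) auto
  finally show thesis
    by (rule that[OF n(1)])
qed

section \<open>Centroids that attain the bound\<close>

definition normalized_indicator :: "'n set \<Rightarrow> real ^ 'n" where
  "normalized_indicator S = (\<chi> j. if j \<in> S then 1 / sqrt (card S) else 0)"

lemma normalized_indicator_in_face: "normalized_indicator S \<in> face S"
  by (simp add: normalized_indicator_def face_def)

lemma normalized_indicator_in_nonneg_sphere:
  assumes "S \<noteq> {}"
  shows "normalized_indicator (S :: 'n::finite set) \<in> nonneg_sphere"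
proof -
  have "(\<Sum>j\<in>UNIV. (normalized_indicator S $ j)\<^sup>2) = (\<Sum>j\<in>S. 1 / real (card S))"
    unfolding normalized_indicator_def by (intro sum.mono_neutral_cong_right) (auto simp: power_divide)
  also have "\<dots> = 1"
    using assms by (simp add: card_eq_0_iff)
  finally have "norm (normalized_indicator S) = 1"
    by (simp add: norm_vec_def L2_set_def)
  then show ?thesis
    by (simp add: nonneg_sphere_def normalized_indicator_def)
qed

lemma normalized_indicator_inner:
  "normalized_indicator S \<bullet> x = (\<Sum>j\<in>S. x $ j) / sqrt (card S)"
  unfolding inner_vec_def normalized_indicator_def sum_divide_distrib
  by (intro sum.mono_neutral_cong_right) auto

text \<open>
  On a face \<open>F\<^sub>I\<^sub>l\<close> only the indicator of the block \<open>I\<^sub>l\<close> has a nonzero inner product with the point,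
  and the maximum coincides with the sum of all inner products.
\<close>

lemma Max_normalized_indicator_inner:
  fixes x :: "real ^ 'n"
  assumes I: "indexed_partition k I" and x: "x \<in> (\<Union>i\<in>{1..k}. face (I i))"
  shows "(MAX i\<in>{1..k}. normalized_indicator (I i) \<bullet> x)
         = (\<Sum>i=1..k. normalized_indicator (I i) \<bullet> x)"
proof -
  let ?v = "\<lambda>i. normalized_indicator (I i) \<bullet> x"
  obtain l where l: "l \<in> {1..k}" "x \<in> face (I l)"
    using x by blast
  have zero: "?v i = 0" if "i \<in> {1..k}" "i \<noteq> l" for i
  proof -
    have "I i \<inter> I l = {}"
      using I l(1) that by (auto simp: indexed_partition_def disjoint_family_on_def)
    then have "(\<Sum>j\<in>I i. x $ j) = 0"
      using l(2) by (intro sum.neutral) (auto simp: face_def)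
    then show ?thesis
      by (simp add: normalized_indicator_inner)
  qed
  have nonneg: "0 \<le> ?v l"
    using l(2) by (simp add: normalized_indicator_inner face_def sum_nonneg)
  have "(MAX i\<in>{1..k}. ?v i) = ?v l"
  proof (rule Max_eqI)
    have "?v i \<le> ?v l" if "i \<in> {1..k}" for i
      using that zero nonneg by (cases "i = l") simp_all
    then show "v \<le> ?v l" if "v \<in> ?v ` {1..k}" for v
      using that by blast
  qed (use l(1) in auto)
  also have "\<dots> = (\<Sum>i=1..k. ?v i)"
    using sum.remove[of "{1..k}" l ?v] l(1) zero by simp
  finally show ?thesis .
qed

lemma expectation_Max_normalized_indicator:
  fixes X :: "'a \<Rightarrow> real ^ 'n"
  assumes M: "prob_space M" and X: "X \<in> borel_measurable M" "\<forall>\<omega>\<in>space M. X \<omega> \<in> nonneg_sphere"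
    and mean: "\<forall>j. (\<integral>\<omega>. X \<omega> $ j \<partial>M) = \<mu>"
    and faces: "\<P>(\<omega> in M. X \<omega> \<in> (\<Union>i\<in>{1..k}. face (I i))) = 1"
    and I: "indexed_partition k I"
  shows "(\<integral>\<omega>. (MAX i\<in>{1..k}. normalized_indicator (I i) \<bullet> X \<omega>) \<partial>M)
         = \<mu> * (\<Sum>i=1..k. sqrt (card (I i)))"
proof -
  interpret prob_space M by fact
  have int: "integrable M (\<lambda>\<omega>. X \<omega> $ j)" for j
    by (intro integrable_component_sphere M X)
  have int_inner: "integrable M (\<lambda>\<omega>. normalized_indicator (I i) \<bullet> X \<omega>)" for i
    unfolding normalized_indicator_inner using int by simp
  have "(\<integral>\<omega>. (MAX i\<in>{1..k}. normalized_indicator (I i) \<bullet> X \<omega>) \<partial>M)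
      = (\<integral>\<omega>. (\<Sum>i=1..k. normalized_indicator (I i) \<bullet> X \<omega>) \<partial>M)"
  proof (rule integral_cong_AE)
    show "(\<lambda>\<omega>. MAX i\<in>{1..k}. normalized_indicator (I i) \<bullet> X \<omega>) \<in> borel_measurable M"
      using int_inner by (intro borel_measurable_Max) auto
    show "(\<lambda>\<omega>. \<Sum>i=1..k. normalized_indicator (I i) \<bullet> X \<omega>) \<in> borel_measurable M"
      using int_inner by (intro borel_measurable_sum) auto
    show "AE \<omega> in M. (MAX i\<in>{1..k}. normalized_indicator (I i) \<bullet> X \<omega>)
        = (\<Sum>i=1..k. normalized_indicator (I i) \<bullet> X \<omega>)"
      using AE_prob_1[OF faces] by eventually_elim (use Max_normalized_indicator_inner[OF I] in blast)
  qed
  also have "\<dots> = (\<Sum>i=1..k. (\<integral>\<omega>. normalized_indicator (I i) \<bullet> X \<omega> \<partial>M))"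
    using int_inner by (intro Bochner_Integration.integral_sum)
  also have "\<dots> = (\<Sum>i=1..k. \<mu> * sqrt (card (I i)))"
  proof (rule sum.cong[OF refl])
    fix i
    have "(\<integral>\<omega>. normalized_indicator (I i) \<bullet> X \<omega> \<partial>M) = \<mu> * (real (card (I i)) / sqrt (card (I i)))"
      unfolding normalized_indicator_inner using int mean by simp
    then show "(\<integral>\<omega>. normalized_indicator (I i) \<bullet> X \<omega> \<partial>M) = \<mu> * sqrt (card (I i))"
      by (simp add: real_div_sqrt)
  qed
  finally show ?thesis
    by (simp add: sum_distrib_left)
qed

lemma ex_optimal_centroids_in_faces:
  fixes X :: "'a \<Rightarrow> real ^ 'n"
  assumes "prob_space M" and "X \<in> borel_measurable M" and "\<forall>\<omega>\<in>space M. X \<omega> \<in> nonneg_sphere"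
    and "\<forall>j. (\<integral>\<omega>. X \<omega> $ j \<partial>M) = \<mu>" and "0 < \<mu>"
    and "\<P>(\<omega> in M. X \<omega> \<in> (\<Union>i\<in>{1..k}. face (I i))) = 1"
    and I: "indexed_partition k I" and "1 \<le> k"
    and max: "yields_max_sqrt_sum CARD('n) k (\<lambda>i. card (I i))"
  shows "\<exists>x. optimal_centroids M X k x \<and> (\<forall>i\<in>{1..k}. x i \<in> face (I i))"
proof (rule exI[of _ "\<lambda>i. normalized_indicator (I i)"], intro conjI ballI)
  show "normalized_indicator (I i) \<in> face (I i)" for i
    by (rule normalized_indicator_in_face)
  show "optimal_centroids M X k (\<lambda>i. normalized_indicator (I i))"
    unfolding optimal_centroids_def is_arg_max_linorder
  proof (intro conjI allI impI ballI)
    show "normalized_indicator (I i) \<in> nonneg_sphere" if "i \<in> {1..k}" for i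
      using I that by (intro normalized_indicator_in_nonneg_sphere) (auto simp: indexed_partition_def)
  next
    fix y :: "nat \<Rightarrow> real ^ 'n"
    assume y: "\<forall>i\<in>{1..k}. y i \<in> nonneg_sphere"
    obtain n where n: "(\<Sum>i=1..k. n i) = CARD('n)"
      "(\<integral>\<omega>. (MAX i\<in>{1..k}. y i \<bullet> X \<omega>) \<partial>M) \<le> \<mu> * (\<Sum>i=1..k. sqrt (real (n i)))"
      using expectation_Max_inner_le[OF assms(1-5) \<open>1 \<le> k\<close> y] .
    have "(\<Sum>i=1..k. sqrt (real (n i))) \<le> (\<Sum>i=1..k. sqrt (card (I i)))"
      using max n(1) unfolding yields_max_sqrt_sum_def is_arg_max_linorder by blast
    then have "\<mu> * (\<Sum>i=1..k. sqrt (real (n i))) \<le> \<mu> * (\<Sum>i=1..k. sqrt (card (I i)))"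
      using \<open>0 < \<mu>\<close> by simp
    with n(2) show "(\<integral>\<omega>. (MAX i\<in>{1..k}. y i \<bullet> X \<omega>) \<partial>M)
        \<le> (\<integral>\<omega>. (MAX i\<in>{1..k}. normalized_indicator (I i) \<bullet> X \<omega>) \<partial>M)"
      unfolding expectation_Max_normalized_indicator[OF assms(1-4,6) I] by simp
  qed
qed

section \<open>Two clusters\<close>

lemma sqrt_add_sqrt_le_iff:
  fixes a b m n :: nat
  assumes "m + n = a + b"
  shows "sqrt m + sqrt n \<le> sqrt a + sqrt b \<longleftrightarrow> m * n \<le> a * b"
proof -
  have "sqrt m + sqrt n \<le> sqrt a + sqrt b \<longleftrightarrow> (sqrt m + sqrt n)\<^sup>2 \<le> (sqrt a + sqrt b)\<^sup>2"
    by (rule power_mono_iff[symmetric]) simp_all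
  also have "\<dots> \<longleftrightarrow> real m + real n + 2 * sqrt (real m * real n)
      \<le> real a + real b + 2 * sqrt (real a * real b)"
    by (simp add: power2_sum real_sqrt_mult mult.assoc)
  also have "\<dots> \<longleftrightarrow> real m * real n \<le> real a * real b"
    using arg_cong[OF assms, of real] by simp
  finally show ?thesis
    by (simp flip: of_nat_mult)
qed

text \<open>
  Moving \<open>t\<close> units from \<open>b\<close> to \<open>a\<close> changes the product by \<open>t (b - a) - t\<^sup>2\<close>. For \<open>|a - b| \<le> 1\<close> this is
  never positive because \<open>|t| \<le> t\<^sup>2\<close> for integers \<open>t\<close>; for \<open>|a - b| \<ge> 2\<close> it is positive for one of
  \<open>t = 1\<close> and \<open>t = -1\<close>.
\<close>

lemma max_product_iff:
  fixes a b :: nat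
  shows "(\<forall>m n. m + n = a + b \<longrightarrow> m * n \<le> a * b) \<longleftrightarrow> \<bar>int a - int b\<bar> \<le> 1"
proof
  assume max: "\<forall>m n. m + n = a + b \<longrightarrow> m * n \<le> a * b"
  have no_gap: "\<not> u + 2 \<le> v" if "u + v = a + b" "u * v = a * b" for u v
  proof
    assume "u + 2 \<le> v"
    then obtain w where v: "v = u + 2 + w"
      by (auto simp: le_iff_add)
    have "(u + 1) * (u + 1 + w) = u * v + 1 + w"
      unfolding v by (simp add: algebra_simps)
    moreover have "(u + 1) + (u + 1 + w) = a + b"
      using v that(1) by simp
    ultimately have "u * v + 1 + w \<le> u * v"
      using max that(2) by metis
    then show False
      by simp
  qed
  show "\<bar>int a - int b\<bar> \<le> 1"
    using no_gap[of a b] no_gap[of b a] by (simp add: add.commute mult.commute)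
next
  assume near: "\<bar>int a - int b\<bar> \<le> 1"
  show "\<forall>m n. m + n = a + b \<longrightarrow> m * n \<le> a * b"
  proof (intro allI impI)
    fix m n assume sum: "m + n = a + b"
    define t where "t = int m - int a"
    have m: "int m = int a + t" and n: "int n = int b - t"
      using sum by (auto simp: t_def)
    have "t * (int b - int a) \<le> \<bar>t\<bar> * \<bar>int b - int a\<bar>"
      by (metis abs_ge_self abs_mult)
    also have "\<dots> \<le> \<bar>t\<bar> * 1"
      using near by (intro mult_left_mono) auto
    also have "\<dots> \<le> \<bar>t\<bar> * \<bar>t\<bar>"
      by (cases "t = 0") (use mult_left_mono[of 1 "\<bar>t\<bar>" "\<bar>t\<bar>"] in auto)
    finally have "int m * int n \<le> int a * int b"
      unfolding m n by (simp add: algebra_simps)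
    then show "m * n \<le> a * b"
      by (simp flip: of_nat_mult)
  qed
qed

lemma yields_max_sqrt_sum_two_iff:
  assumes "n 1 + n 2 = d"
  shows "yields_max_sqrt_sum d 2 n \<longleftrightarrow> \<bar>int (n 1) - int (n 2)\<bar> \<le> 1"
proof -
  have two: "(\<Sum>i=1..2. h i) = h 1 + h 2" for h :: "nat \<Rightarrow> 'b::comm_monoid_add"
    by (simp add: numeral_2_eq_2)
  \<comment> \<open>Only the values at 1 and 2 matter, so pairs can replace functions.\<close>
  have pairs: "(\<forall>m :: nat \<Rightarrow> nat. P (m 1) (m 2)) \<longleftrightarrow> (\<forall>u v. P u v)" for P
  proof
    assume all: "\<forall>m :: nat \<Rightarrow> nat. P (m 1) (m 2)"
    show "\<forall>u v. P u v"
    proof (intro allI)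
      show "P u v" for u v
        using all[rule_format, of "\<lambda>i. if i = 1 then u else v"] by simp
    qed
  qed simp
  have "yields_max_sqrt_sum d 2 n \<longleftrightarrow>
      (\<forall>m :: nat \<Rightarrow> nat. m 1 + m 2 = n 1 + n 2 \<longrightarrow> sqrt (m 1) + sqrt (m 2) \<le> sqrt (n 1) + sqrt (n 2))"
    using assms unfolding yields_max_sqrt_sum_def is_arg_max_linorder two by simp
  also have "\<dots> \<longleftrightarrow> (\<forall>u v. u + v = n 1 + n 2 \<longrightarrow> sqrt u + sqrt v \<le> sqrt (n 1) + sqrt (n 2))"
    by (rule pairs)
  also have "\<dots> \<longleftrightarrow> (\<forall>u v. u + v = n 1 + n 2 \<longrightarrow> u * v \<le> n 1 * n 2)"
    using sqrt_add_sqrt_le_iff by blast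
  finally show ?thesis
    unfolding max_product_iff .
qed

lemma sum_card_indexed_partition:
  fixes I :: "nat \<Rightarrow> 'n::finite set"
  assumes "indexed_partition k I"
  shows "(\<Sum>i=1..k. card (I i)) = CARD('n)"
  using assms card_UN_disjoint[of "{1..k}" I]
  by (auto simp: indexed_partition_def disjoint_family_on_def)

section \<open>Optimal centroids in the faces of a partition\<close>

theorem theorem4p2:
  fixes M :: "'a measure" and X :: "'a \<Rightarrow> real ^ 'n" and \<mu> :: real
    and k :: nat and I :: "nat \<Rightarrow> 'n set"
  assumes "2 \<le> k" and "k \<le> CARD('n)"
    and "indexed_partition k I"
  shows "(prob_space M \<and> X \<in> borel_measurable M \<and> (\<forall>\<omega>\<in>space M. X \<omega> \<in> nonneg_sphere) \<and>
          (\<forall>i. (\<integral>\<omega>. X \<omega> $ i \<partial>M) = \<mu>) \<and> \<mu> > 0 \<and>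
          \<P>(\<omega> in M. X \<omega> \<in> (\<Union>i\<in>{1..k}. face (I i))) = 1 \<and>
          yields_max_sqrt_sum CARD('n) k (\<lambda>i. card (I i))
            \<longrightarrow> (\<exists>x. optimal_centroids M X k x \<and> (\<forall>i\<in>{1..k}. x i \<in> face (I i)))) \<and>
         (k = 2 \<longrightarrow>
          (yields_max_sqrt_sum CARD('n) 2 (\<lambda>i. card (I i))
            \<longleftrightarrow> \<bar>int (card (I 1)) - int (card (I 2))\<bar> \<le> 1))"
proof (rule conjI)
  show "prob_space M \<and> X \<in> borel_measurable M \<and> (\<forall>\<omega>\<in>space M. X \<omega> \<in> nonneg_sphere) \<and>
          (\<forall>i. (\<integral>\<omega>. X \<omega> $ i \<partial>M) = \<mu>) \<and> \<mu> > 0 \<and>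
          \<P>(\<omega> in M. X \<omega> \<in> (\<Union>i\<in>{1..k}. face (I i))) = 1 \<and>
          yields_max_sqrt_sum CARD('n) k (\<lambda>i. card (I i))
            \<longrightarrow> (\<exists>x. optimal_centroids M X k x \<and> (\<forall>i\<in>{1..k}. x i \<in> face (I i)))"
    using ex_optimal_centroids_in_faces[of M X \<mu> I k] assms(1,3) by auto
  show "k = 2 \<longrightarrow>
          (yields_max_sqrt_sum CARD('n) 2 (\<lambda>i. card (I i))
            \<longleftrightarrow> \<bar>int (card (I 1)) - int (card (I 2))\<bar> \<le> 1)"
  proof
    assume "k = 2"
    then have "card (I 1) + card (I 2) = CARD('n)"
      using sum_card_indexed_partition[OF assms(3)] by (simp add: numeral_2_eq_2)
    then show "yields_max_sqrt_sum CARD('n) 2 (\<lambda>i. card (I i))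
            \<longleftrightarrow> \<bar>int (card (I 1)) - int (card (I 2))\<bar> \<le> 1"
      by (rule yields_max_sqrt_sum_two_iff)
  qed
qed

end
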